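(* Let $f:\mathbb{R}^2\to\mathbb{R}$ be a smooth function, defined on the entire $xy$-plane, whose graph $\{(x,y,f(x,y)):(x,y)\in\mathbb{R}^2\}$ is a minimal surface in $\mathcal{H}_3$, and suppose that there is a constant $k$ with $|f(x,y)|\le k$ for all $(x,y)\in\mathbb{R}^2$. Then $f$ is constant.
   Context: The Heisenberg group $\mathcal{H}_3$ is $\mathbb{R}^3$ with the product $(x_1,y_1,z_1)*(x_2,y_2,z_2)=(x_1+x_2,\,y_1+y_2,\,z_1+z_2+\frac{x_1y_2-x_2y_1}{2})$, equipped with the left-invariant Riemannian metric $ds^2=dx^2+dy^2+(\frac12 y\,dx-\frac12 x\,dy+dz)^2$. A surface is minimal if its mean curvature vanishes identically; for the graph of a smooth function $f$ this is the equation $$\Big(1+\big(f_y-\tfrac x2\big)^2\Big)f_{xx}-2\big(f_y-\tfrac x2\big)\big(f_x+\tfrac y2\big)f_{xy}+\Big(1+\big(f_x+\tfrac y2\big)^2\Big)f_{yy}=0.$$ *)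

theory Defs
  imports "HOL-Analysis.Analysis"
begin

definition partial_deriv ::
    "'n::finite \<Rightarrow> (real^'n \<Rightarrow> 'b::real_normed_vector) \<Rightarrow> real^'n \<Rightarrow> 'b" where
  "partial_deriv i f = (\<lambda>x. frechet_derivative f (at x) (axis i 1))"

text \<open>Smoothness on an open set: every iterated partial derivative, including \<open>f\<close> itself
  (the empty list), is differentiable, hence continuous, at each point of the set.\<close>

definition smooth_on :: "(real^'n::finite) set \<Rightarrow> (real^'n \<Rightarrow> 'b::real_normed_vector) \<Rightarrow> bool" where
  "smooth_on U f \<longleftrightarrow> (\<forall>is. \<forall>x\<in>U. foldr partial_deriv is f differentiable (at x))"

text \<open>A Riemannian metric on \<open>real^'n\<close> is given by its field \<open>g\<close> of Gram matrices with respect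
  to the coordinate vector fields.\<close>

definition metric_inner :: "(real^'n::finite \<Rightarrow> real^'n^'n) \<Rightarrow> real^'n \<Rightarrow> real^'n \<Rightarrow> real^'n \<Rightarrow> real" where
  "metric_inner g p u v = u \<bullet> (g p *v v)"

text \<open>Christoffel symbols \<open>\<Gamma>\<^sup>k\<^sub>i\<^sub>j\<close> of the Levi-Civita connection.\<close>

definition christoffel ::
    "(real^'n::finite \<Rightarrow> real^'n^'n) \<Rightarrow> real^'n \<Rightarrow> 'n \<Rightarrow> 'n \<Rightarrow> 'n \<Rightarrow> real" where
  "christoffel g p k i j = (\<Sum>l\<in>UNIV. matrix_inv (g p) $ k $ l *
      (partial_deriv i (\<lambda>q. g q $ j $ l) p + partial_deriv j (\<lambda>q. g q $ i $ l) p
        - partial_deriv l (\<lambda>q. g q $ i $ j) p)) / 2"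

text \<open>The ambient covariant derivative \<open>\<nabla>\<^bsub>\<partial>\<^sub>iX\<^esub> \<partial>\<^sub>jX\<close> along a parametrized
  submanifold \<open>X\<close>.\<close>

definition cov_deriv ::
    "(real^'n::finite \<Rightarrow> real^'n^'n) \<Rightarrow> (real^'m::finite \<Rightarrow> real^'n) \<Rightarrow> 'm \<Rightarrow> 'm \<Rightarrow> real^'m \<Rightarrow> real^'n" where
  "cov_deriv g X i j u = partial_deriv i (partial_deriv j X) u +
      (\<chi> k. \<Sum>a\<in>UNIV. \<Sum>b\<in>UNIV. christoffel g (X u) k a b
         * (partial_deriv i X u $ a) * (partial_deriv j X u $ b))"

definition first_fundamental_form ::
    "(real^'n::finite \<Rightarrow> real^'n^'n) \<Rightarrow> (real^'m::finite \<Rightarrow> real^'n) \<Rightarrow> real^'m \<Rightarrow> real^'m^'m" where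
  "first_fundamental_form g X u =
      (\<chi> i j. metric_inner g (X u) (partial_deriv i X u) (partial_deriv j X u))"

definition second_fundamental_form ::
    "(real^'n::finite \<Rightarrow> real^'n^'n) \<Rightarrow> (real^'m::finite \<Rightarrow> real^'n) \<Rightarrow> real^'n \<Rightarrow> real^'m \<Rightarrow> real^'m^'m" where
  "second_fundamental_form g X \<nu> u = (\<chi> i j. metric_inner g (X u) (cov_deriv g X i j u) \<nu>)"

definition unit_normal ::
    "(real^'n::finite \<Rightarrow> real^'n^'n) \<Rightarrow> (real^'m::finite \<Rightarrow> real^'n) \<Rightarrow> real^'m \<Rightarrow> real^'n \<Rightarrow> bool" where
  "unit_normal g X u \<nu> \<longleftrightarrow> metric_inner g (X u) \<nu> \<nu> = 1 \<and>
      (\<forall>i. metric_inner g (X u) (partial_deriv i X u) \<nu> = 0)"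

definition mean_curvature ::
    "(real^3 \<Rightarrow> real^3^3) \<Rightarrow> (real^2 \<Rightarrow> real^3) \<Rightarrow> real^3 \<Rightarrow> real^2 \<Rightarrow> real" where
  "mean_curvature g X \<nu> u =
      trace (matrix_inv (first_fundamental_form g X u) ** second_fundamental_form g X \<nu> u) / 2"

text \<open>At each point of an immersion there are exactly two unit normals, \<open>\<nu>\<close> and \<open>-\<nu>\<close>;
  they give mean
  curvatures of opposite sign.\<close>

definition minimal_surface ::
    "(real^3 \<Rightarrow> real^3^3) \<Rightarrow> (real^2) set \<Rightarrow> (real^2 \<Rightarrow> real^3) \<Rightarrow> bool" where
  "minimal_surface g U X \<longleftrightarrow> open U \<and> smooth_on U X \<and>
      (\<forall>u\<in>U. inj (frechet_derivative X (at u))) \<and>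
      (\<forall>u\<in>U. \<forall>\<nu>. unit_normal g X u \<nu> \<longrightarrow> mean_curvature g X \<nu> u = 0)"

definition heis_mult :: "real^3 \<Rightarrow> real^3 \<Rightarrow> real^3" where
  "heis_mult p q = vector [p$1 + q$1, p$2 + q$2, p$3 + q$3 + (p$1 * q$2 - q$1 * p$2) / 2]"

text \<open>The left-invariant contact form \<open>\<omega> = y/2 dx - x/2 dy + dz\<close>, as a covector;
  the metric is \<open>dx\<^sup>2 + dy\<^sup>2 + \<omega>\<^sup>2\<close>.\<close>

definition heis_form :: "real^3 \<Rightarrow> real^3" where
  "heis_form p = vector [p$2 / 2, - (p$1 / 2), 1]"

definition heis_metric :: "real^3 \<Rightarrow> real^3^3" where
  "heis_metric p = (\<chi> i j. (if i = j \<and> i \<noteq> 3 then 1 else 0) + heis_form p $ i * heis_form p $ j)"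

lemma metric_inner_heis_metric:
  "metric_inner heis_metric p u v =
     u$1 * v$1 + u$2 * v$2 +
     (p$2 / 2 * u$1 - p$1 / 2 * u$2 + u$3) * (p$2 / 2 * v$1 - p$1 / 2 * v$2 + v$3)"
  by (simp add: metric_inner_def heis_metric_def heis_form_def inner_vec_def matrix_vector_mult_def
      sum_3 algebra_simps)

lemma has_derivative_heis_mult:
  "(heis_mult p has_derivative (\<lambda>u. vector [u$1, u$2, u$3 + (p$1 * u$2 - u$1 * p$2) / 2])) (at q)"
  unfolding heis_mult_def
  apply (subst has_derivative_componentwise_within)
  apply (auto simp: Basis_vec_def inner_axis forall_3
      intro!: derivative_eq_intros bounded_linear.has_derivative[OF bounded_linear_vec_nth])
  done

lemma heis_metric_left_invariant:
  "metric_inner heis_metric (heis_mult p q)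
     (frechet_derivative (heis_mult p) (at q) u) (frechet_derivative (heis_mult p) (at q) v)
   = metric_inner heis_metric q u v"
  unfolding frechet_derivative_at[OF has_derivative_heis_mult, symmetric]
  by (simp add: metric_inner_heis_metric heis_mult_def) (simp add: field_simps)

definition graph_param :: "(real^2 \<Rightarrow> real) \<Rightarrow> real^2 \<Rightarrow> real^3" where
  "graph_param f u = vector [u$1, u$2, f u]"

end

theory Submission
  imports Defs
begin

text \<open>Write \<open>A(v) = v / sqrt (1 + |v|\<^sup>2)\<close> and \<open>a = (y/2, -x/2)\<close>. The graph of \<open>f\<close> is minimal iff
  \<open>A(\<nabla>f + a)\<close> is divergence free; this also holds for the zero function, so
  \<open>V = A(\<nabla>f + a) - A(a)\<close> is divergence free. As in the Collin--Krust argument,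
  \<open>\<nabla>f \<bullet> V \<ge> |V|\<^sup>2\<close>. Testing \<open>div V = 0\<close> against \<open>\<phi>\<^sup>2 f\<close> bounds the integral of \<open>\<phi>\<^sup>2 |V|\<^sup>2\<close> by a multiple
  of \<open>(sup |f|)\<^sup>2\<close> times the Dirichlet energy of \<open>\<phi>\<close>, which tends to 0 along logarithmic cutoffs
  because the plane is parabolic. Hence \<open>V = 0\<close>, and \<open>\<nabla>f = 0\<close> since \<open>A\<close> is injective.\<close>

subsection \<open>Parabolicity of the plane\<close>

text \<open>Divergence theorem on a square without flux: by Fubini each summand reduces to
  one-variable integrals of a derivative, whose primitive vanishes at both endpoints.\<close>

lemma integral_divergence_eq_0:
  fixes P Q P' Q' :: "real \<Rightarrow> real \<Rightarrow> real"
  assumes R: "0 \<le> R"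
    and P: "\<And>x y. ((\<lambda>x. P x y) has_real_derivative P' x y) (at x)"
    and Q: "\<And>x y. ((\<lambda>y. Q x y) has_real_derivative Q' x y) (at y)"
    and cP: "continuous_on UNIV (\<lambda>(x, y). P' x y)"
    and cQ: "continuous_on UNIV (\<lambda>(x, y). Q' x y)"
    and P0: "\<And>y. P R y = 0" "\<And>y. P (- R) y = 0"
    and Q0: "\<And>x. Q x R = 0" "\<And>x. Q x (- R) = 0"
  shows "integral (cbox (- R, - R) (R, R)) (\<lambda>(x, y). P' x y + Q' x y) = 0"
proof -
  let ?S = "cbox (- R, - R) (R, R)"
  have zero: "integral {- R..R} g' = 0"
    if "\<And>t. (g has_real_derivative g' t) (at t)" "g R = 0" "g (- R) = 0" for g g' :: "real \<Rightarrow> real"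
  proof -
    have "(g' has_integral g R - g (- R)) {- R..R}"
      using R that(1) by (intro fundamental_theorem_of_calculus)
        (auto simp: has_real_derivative_iff_has_vector_derivative intro: has_vector_derivative_at_within)
    then show ?thesis using that by (simp add: integral_unique)
  qed
  have iP: "(\<lambda>(x, y). P' x y) integrable_on ?S" and iQ: "(\<lambda>(x, y). Q' x y) integrable_on ?S"
    using cP cQ by (auto intro!: integrable_continuous intro: continuous_on_subset)
  have "integral ?S (\<lambda>(x, y). P' x y + Q' x y)
      = integral ?S (\<lambda>(x, y). P' x y) + integral ?S (\<lambda>(x, y). Q' x y)"
    using integral_add[OF iP iQ] by (simp add: case_prod_unfold)
  moreover have "integral ?S (\<lambda>(x, y). Q' x y) = 0"
  proof -
    have "integral {- R..R} (Q' x) = 0" for x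
      using zero[of "Q x" "Q' x"] Q Q0 by simp
    then show ?thesis
      using integral_prod_continuous[of "-R" "-R" R R "\<lambda>(x, y). Q' x y"] cQ
      by (auto intro: continuous_on_subset simp: cbox_interval)
  qed
  \<comment> \<open>Iterated integration puts \<open>y\<close> innermost, so the order is swapped to
    integrate \<open>P'\<close> along \<open>x\<close> first.\<close>
  moreover have "integral ?S (\<lambda>(x, y). P' x y) = 0"
  proof -
    have "integral {- R..R} (\<lambda>x. P' x y) = 0" for y
      using zero[of "\<lambda>x. P x y" "\<lambda>x. P' x y"] P P0 by simp
    then show ?thesis
      using integral_prod_continuous[of "-R" "-R" R R "\<lambda>(x, y). P' x y"]
        integral_swap_continuous[of "-R" "-R" R R P'] cP
      by (auto intro: continuous_on_subset simp: cbox_interval)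
  qed
  ultimately show ?thesis by simp
qed

text \<open>The inner integral is an arctangent difference, at most
  \<open>pi / sqrt (1 + x^2)\<close>, and the outer one is then an \<open>arsinh\<close>. The growth
  is only logarithmic in \<open>R\<close>, which is the parabolicity of the plane; the bound
  controls the Dirichlet energy of the cutoffs below.\<close>

lemma integral_inverse_quadratic_le:
  fixes R :: real
  assumes "2 \<le> R"
  shows "integral (cbox (- R, - R) (R, R)) (\<lambda>(x, y). 1 / (1 + x\<^sup>2 + y\<^sup>2)) \<le> 2 * pi * ln (1 + R\<^sup>2)"
proof -
  have R: "0 \<le> R" "- R \<le> R" using assms by auto
  have nz: "1 + x\<^sup>2 + y\<^sup>2 \<noteq> 0" "1 + x\<^sup>2 + y\<^sup>2 > 0" for x y :: real
    by (smt (verit) zero_le_power2)+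
  have c: "continuous_on UNIV (\<lambda>(x::real, y::real). 1 / (1 + x\<^sup>2 + y\<^sup>2))"
    unfolding case_prod_unfold by (intro continuous_intros ballI nz)
  have inner: "integral {- R..R} (\<lambda>y. 1 / (1 + x\<^sup>2 + y\<^sup>2)) \<le> pi * (1 / sqrt (1 + x\<^sup>2))" for x
  proof -
    define c where "c = sqrt (1 + x\<^sup>2)"
    have c: "c > 0" "c\<^sup>2 = 1 + x\<^sup>2" unfolding c_def by (auto simp: add_pos_nonneg)
    have "((\<lambda>y. arctan (y / c) / c) has_real_derivative 1 / (1 + x\<^sup>2 + y\<^sup>2)) (at y within {- R..R})" for y
    proof -
      have "(1 + (y / c)\<^sup>2) * (c * c) = c\<^sup>2 + y\<^sup>2"
        using c(1) by (simp add: power_divide distrib_right power2_eq_square)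
      moreover have "1 / c / (1 + (y / c)\<^sup>2) / c = 1 / ((1 + (y / c)\<^sup>2) * (c * c))"
        by (simp add: ac_simps)
      ultimately have "1 / c / (1 + (y / c)\<^sup>2) / c = 1 / (c\<^sup>2 + y\<^sup>2)"
        by presburger
      then show ?thesis
        using c(1) unfolding c(2)[symmetric] by (auto intro!: derivative_eq_intros simp: inverse_eq_divide mult_ac)
    qed
    then have "((\<lambda>y. 1 / (1 + x\<^sup>2 + y\<^sup>2)) has_integral arctan (R / c) / c - arctan (- R / c) / c) {- R..R}"
      using fundamental_theorem_of_calculus[OF R(2), of "\<lambda>y. arctan (y / c) / c"]
      by (simp add: has_real_derivative_iff_has_vector_derivative)
    then have "integral {- R..R} (\<lambda>y. 1 / (1 + x\<^sup>2 + y\<^sup>2)) = (arctan (R / c) - arctan (- R / c)) / c"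
      by (simp add: integral_unique diff_divide_distrib)
    also have "\<dots> \<le> pi / c"
      using arctan_ubound[of "R / c"] arctan_lbound[of "- R / c"] c
      by (intro divide_right_mono) auto
    finally show ?thesis unfolding c_def by simp
  qed
  have outer: "((\<lambda>x. pi * (1 / sqrt (1 + x\<^sup>2))) has_integral pi * arsinh R - pi * arsinh (- R)) {- R..R}"
  proof (rule fundamental_theorem_of_calculus[OF R(2)])
    show "((\<lambda>x. pi * arsinh x) has_vector_derivative pi * (1 / sqrt (1 + x\<^sup>2))) (at x within {- R..R})" for x
      unfolding has_real_derivative_iff_has_vector_derivative[symmetric]
      by (auto intro!: derivative_eq_intros simp: add.commute)
  qed
  have "integral (cbox (- R, - R) (R, R)) (\<lambda>(x, y). 1 / (1 + x\<^sup>2 + y\<^sup>2))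
      = integral {- R..R} (\<lambda>x. integral {- R..R} (\<lambda>y. 1 / (1 + x\<^sup>2 + y\<^sup>2)))"
    using integral_prod_continuous[of "-R" "-R" R R "\<lambda>(x, y). 1 / (1 + x\<^sup>2 + y\<^sup>2)"] c
    by (auto intro: continuous_on_subset simp: cbox_interval)
  also have "\<dots> \<le> integral {- R..R} (\<lambda>x. pi * (1 / sqrt (1 + x\<^sup>2)))"
  proof (rule integral_le)
    show "(\<lambda>x. integral {- R..R} (\<lambda>y. 1 / (1 + x\<^sup>2 + y\<^sup>2))) integrable_on {- R..R}"
      using integral_integrable_2dim[of "-R" "-R" R R "\<lambda>(x, y). 1 / (1 + x\<^sup>2 + y\<^sup>2)"] c
      by (auto intro: continuous_on_subset simp: cbox_interval case_prod_unfold)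
  qed (use outer inner in auto)
  also have "\<dots> = 2 * pi * arsinh R"
    using outer by (simp add: integral_unique)
  also have "arsinh R \<le> ln (1 + R\<^sup>2)"
  proof -
    \<comment> \<open>From \<open>2 \<le> R\<close> follows \<open>2 \<le> t\<close>, hence
      \<open>R + t \<le> 2 * t \<le> t * t = 1 + R^2\<close>.\<close>
    define t where "t = sqrt (1 + R\<^sup>2)"
    have t: "2 \<le> t" "R \<le> t" "t * t = 1 + R\<^sup>2"
      unfolding t_def using assms mult_mono[of 2 R 2 R] by (auto intro!: real_le_rsqrt simp: power2_eq_square)
    have "arsinh R = ln (R + t)"
      by (simp add: arsinh_real_def t_def add.commute)
    also have "\<dots> \<le> ln (t * t)"
      using t assms mult_right_mono[of 2 t t] by (intro ln_mono) auto
    finally show ?thesis using t by simp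
  qed
  finally show ?thesis by simp
qed

text \<open>Squaring removes the corner of \<open>max 0 x\<close> at the origin: the difference
  quotient there is bounded by \<open>|h|\<close>. A cutoff that enters only through its square can
  thus be differentiated classically.\<close>

lemma max_0_square_has_real_derivative:
  fixes x :: real
  shows "((\<lambda>x. (max 0 x)\<^sup>2) has_real_derivative 2 * max 0 x) (at x)"
proof -
  consider "x < 0" | "x = 0" | "0 < x" by linarith
  then show ?thesis
  proof cases
    case 1
    show ?thesis
      by (rule has_field_derivative_transform_within_open[of "\<lambda>_. 0" _ x "{..<0}"]) (use 1 in auto)
  next
    case 2
    have "((\<lambda>h. (max 0 h)\<^sup>2 / h) \<longlongrightarrow> (0::real)) (at 0)"
    proof (rule Lim_null_comparison)
      have "norm ((max 0 h)\<^sup>2 / h) \<le> \<bar>h\<bar>" for h :: real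
        by (cases "h > 0") (auto simp: power2_eq_square max_def)
      then show "\<forall>\<^sub>F h in at 0. norm ((max 0 h)\<^sup>2 / h) \<le> \<bar>h::real\<bar>"
        by simp
      show "((\<lambda>h::real. \<bar>h\<bar>) \<longlongrightarrow> 0) (at 0)"
        using tendsto_rabs_zero[OF tendsto_ident_at] by simp
    qed
    then show ?thesis using 2 by (simp add: DERIV_def)
  next
    case 3
    show ?thesis
      by (rule has_field_derivative_transform_within_open[of "\<lambda>y. y\<^sup>2" _ x "{0<..}"])
        (use 3 in \<open>auto intro!: derivative_eq_intros\<close>)
  qed
qed

lemma DERIV_max_0_square [derivative_intros]:
  assumes "(g has_real_derivative D) (at x within S)"
  shows "((\<lambda>x. (max 0 (g x))\<^sup>2) has_real_derivative (2 * max 0 (g x) * D)) (at x within S)"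
  using DERIV_chain2[OF max_0_square_has_real_derivative assms] by simp

text \<open>A Liouville theorem by the Caccioppoli method: with a logarithmic cutoff reaching to
  radius \<open>R\<close>, the weighted integral of \<open>|V|^2\<close> is of order
  \<open>k^2 / ln (1 + R^2)\<close>, while the weight stays above a positive constant on any fixed
  square as \<open>R\<close> grows.\<close>

lemma divergence_free_field_eq_0:
  fixes f f1 f2 V1 V2 V11 V22 :: "real \<Rightarrow> real \<Rightarrow> real"
  assumes f1: "\<And>x y. ((\<lambda>x. f x y) has_real_derivative f1 x y) (at x)"
    and f2: "\<And>x y. ((\<lambda>y. f x y) has_real_derivative f2 x y) (at y)"
    and V1: "\<And>x y. ((\<lambda>x. V1 x y) has_real_derivative V11 x y) (at x)"
    and V2: "\<And>x y. ((\<lambda>y. V2 x y) has_real_derivative V22 x y) (at y)"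
    and cont: "continuous_on UNIV (\<lambda>(x, y). f x y)"
      "continuous_on UNIV (\<lambda>(x, y). f1 x y)" "continuous_on UNIV (\<lambda>(x, y). f2 x y)"
      "continuous_on UNIV (\<lambda>(x, y). V1 x y)" "continuous_on UNIV (\<lambda>(x, y). V2 x y)"
      "continuous_on UNIV (\<lambda>(x, y). V11 x y)" "continuous_on UNIV (\<lambda>(x, y). V22 x y)"
    and bounded: "\<And>x y. \<bar>f x y\<bar> \<le> k"
    and div: "\<And>x y. V11 x y + V22 x y = 0"
    and coercive: "\<And>x y. (V1 x y)\<^sup>2 + (V2 x y)\<^sup>2 \<le> f1 x y * V1 x y + f2 x y * V2 x y"
  shows "V1 x y = 0 \<and> V2 x y = 0"
proof -
  define g where "g = (\<lambda>x y. (V1 x y)\<^sup>2 + (V2 x y)\<^sup>2)"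
  \<comment> \<open>The summand 1 keeps \<open>ln \<rho>\<close> smooth at the origin and
    nonnegative everywhere.\<close>
  define \<rho> where "\<rho> = (\<lambda>x y::real. 1 + x\<^sup>2 + y\<^sup>2)"
  have \<rho>: "\<rho> x y > 0" "\<rho> x y \<ge> 1" "\<rho> x y \<noteq> 0" for x y
    unfolding \<rho>_def by (smt (verit) zero_le_power2)+
  have c\<rho>: "continuous_on S (\<lambda>p. \<rho> (fst p) (snd p))" for S
    unfolding \<rho>_def by (intro continuous_intros)
  note cont' = cont[unfolded case_prod_unfold]
  have cont_g: "continuous_on UNIV (\<lambda>(x, y). g x y)"
    unfolding g_def case_prod_unfold by (intro continuous_intros cont')
  have weighted: "integral (cbox (- R, - R) (R, R))
      (\<lambda>(x, y). (max 0 (1 - ln (\<rho> x y) / ln (1 + R\<^sup>2)))\<^sup>2 * g x y) \<le> 32 * pi * k\<^sup>2 / ln (1 + R\<^sup>2)"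
    if R: "2 \<le> R" for R
  proof -
    define S where "S = cbox (- R, - R) (R, R)"
    define L where "L = ln (1 + R\<^sup>2)"
    \<comment> \<open>The logarithmic cutoff vanishes as soon as \<open>x^2 + y^2 \<ge> R^2\<close>,
      in particular on the sides of the square.\<close>
    define m where "m = (\<lambda>x y. max 0 (1 - ln (\<rho> x y) / L))"
    have L: "L > 0" unfolding L_def using R by (auto intro!: ln_gt_zero)
    have cm: "continuous_on S (\<lambda>p. m (fst p) (snd p))" for S
      unfolding m_def using \<rho> L by (intro continuous_intros c\<rho>) auto
    have m0: "m x y = 0" if "\<bar>x\<bar> = R \<or> \<bar>y\<bar> = R" for x y
    proof -
      have "x\<^sup>2 = R\<^sup>2 \<or> y\<^sup>2 = R\<^sup>2" using that by (metis power2_abs)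
      then have "\<rho> x y \<ge> 1 + R\<^sup>2" unfolding \<rho>_def by auto
      then have "ln (\<rho> x y) \<ge> L"
        unfolding L_def using \<rho>[of x y] by (intro ln_mono) (auto simp: add_pos_nonneg)
      then show ?thesis unfolding m_def using L by (simp add: field_simps)
    qed
    define h1 where "h1 = (\<lambda>x y. 2 * m x y * (- (2 * x / \<rho> x y / L)))"
    define h2 where "h2 = (\<lambda>x y. 2 * m x y * (- (2 * y / \<rho> x y / L)))"
    have \<rho>1: "((\<lambda>x. \<rho> x y) has_real_derivative 2 * x) (at x)"
      and \<rho>2: "((\<lambda>y. \<rho> x y) has_real_derivative 2 * y) (at y)" for x y
      unfolding \<rho>_def by (auto intro!: derivative_eq_intros)
    have h1: "((\<lambda>x. (m x y)\<^sup>2) has_real_derivative h1 x y) (at x)"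
      and h2: "((\<lambda>y. (m x y)\<^sup>2) has_real_derivative h2 x y) (at y)" for x y
      unfolding m_def h1_def h2_def using \<rho>[of x y] L
      by (auto intro!: derivative_eq_intros \<rho>1 \<rho>2)
    \<comment> \<open>\<open>(P, Q)\<close> is the test field \<open>m^2 f V\<close>;
      \<open>P'\<close> and \<open>Q'\<close> have the shape that \<open>DERIV_mult\<close> yields,
      and their sum is its divergence.\<close>
    define P where "P = (\<lambda>x y. (m x y)\<^sup>2 * f x y * V1 x y)"
    define Q where "Q = (\<lambda>x y. (m x y)\<^sup>2 * f x y * V2 x y)"
    define P' where "P' = (\<lambda>x y. (h1 x y * f x y + f1 x y * (m x y)\<^sup>2) * V1 x y + V11 x y * ((m x y)\<^sup>2 * f x y))"
    define Q' where "Q' = (\<lambda>x y. (h2 x y * f x y + f2 x y * (m x y)\<^sup>2) * V2 x y + V22 x y * ((m x y)\<^sup>2 * f x y))"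
    have cP: "continuous_on UNIV (\<lambda>(x, y). P' x y)" and cQ: "continuous_on UNIV (\<lambda>(x, y). Q' x y)"
      unfolding P'_def Q'_def h1_def h2_def case_prod_unfold
      using \<rho> L by (auto intro!: continuous_intros cont' cm c\<rho>)
    have int0: "integral S (\<lambda>(x, y). P' x y + Q' x y) = 0"
      unfolding S_def
    proof (rule integral_divergence_eq_0[OF _ _ _ cP cQ])
      show "((\<lambda>x. P x y) has_real_derivative P' x y) (at x)" for x y
        unfolding P_def P'_def by (intro DERIV_mult h1 f1 V1)
      show "((\<lambda>y. Q x y) has_real_derivative Q' x y) (at y)" for x y
        unfolding Q_def Q'_def by (intro DERIV_mult h2 f2 V2)
    qed (use R m0 in \<open>auto simp: P_def Q_def\<close>)
    have pointwise: "(m x y)\<^sup>2 * g x y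
        \<le> 2 * (P' x y + Q' x y) + 16 * k\<^sup>2 / L\<^sup>2 * (1 / (1 + x\<^sup>2 + y\<^sup>2))" for x y
    proof -
      \<comment> \<open>Where the cutoff is positive its gradient is \<open>(-a, -b)\<close>, so
        \<open>U\<close> is, up to sign, the cross term of the divergence.\<close>
      define a where "a = 2 * x / \<rho> x y / L"
      define b where "b = 2 * y / \<rho> x y / L"
      define M where "M = m x y"
      define U where "U = f x y * M * (a * V1 x y + b * V2 x y)"
      have "P' x y + Q' x y = M\<^sup>2 * (f1 x y * V1 x y + f2 x y * V2 x y)
          - 2 * U + (V11 x y + V22 x y) * (M\<^sup>2 * f x y)"
        unfolding P'_def Q'_def h1_def h2_def a_def[symmetric] b_def[symmetric] M_def[symmetric] U_def
        by (simp add: algebra_simps)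
      then have "P' x y + Q' x y = M\<^sup>2 * (f1 x y * V1 x y + f2 x y * V2 x y) - 2 * U"
        using div by simp
      moreover have "M\<^sup>2 * g x y \<le> M\<^sup>2 * (f1 x y * V1 x y + f2 x y * V2 x y)"
        unfolding g_def by (intro mult_left_mono coercive) auto
      \<comment> \<open>Young's inequality for the cross term: doubling the divergence identity
        leaves \<open>2 M^2 g\<close> against \<open>4 U\<close>, and half of it absorbs the
        \<open>M^2 g\<close> produced here. What remains, \<open>4 f^2 (a^2 + b^2)\<close>, gives
        the constant 16.\<close>
      moreover have "0 \<le> (M * V1 x y - 2 * f x y * a)\<^sup>2 + (M * V2 x y - 2 * f x y * b)\<^sup>2"
        by simp
      then have "4 * U \<le> M\<^sup>2 * g x y + 4 * ((f x y)\<^sup>2 * (a\<^sup>2 + b\<^sup>2))"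
        unfolding g_def U_def by (simp add: algebra_simps power2_eq_square)
      moreover have "(f x y)\<^sup>2 * (a\<^sup>2 + b\<^sup>2) \<le> k\<^sup>2 * (4 / L\<^sup>2 * (1 / \<rho> x y))"
      proof (rule mult_mono)
        show "(f x y)\<^sup>2 \<le> k\<^sup>2"
          using bounded[of x y] by (simp add: abs_le_square_iff[symmetric])
        have "a\<^sup>2 + b\<^sup>2 = 4 / L\<^sup>2 * ((\<rho> x y - 1) / (\<rho> x y)\<^sup>2)"
          unfolding a_def b_def using \<rho>(3)[of x y] L
          by (simp add: field_simps) (simp add: \<rho>_def power2_eq_square algebra_simps)
        also have "\<dots> \<le> 4 / L\<^sup>2 * (1 / \<rho> x y)"
          using \<rho>[of x y] by (intro mult_left_mono) (auto simp: field_simps power2_eq_square)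
        finally show "a\<^sup>2 + b\<^sup>2 \<le> 4 / L\<^sup>2 * (1 / \<rho> x y)" .
      qed auto
      ultimately show ?thesis
        unfolding M_def[symmetric] \<rho>_def by simp
    qed
    have c1: "continuous_on UNIV (\<lambda>(x, y). 1 / (1 + x\<^sup>2 + y\<^sup>2 :: real))"
      using \<rho>(3) unfolding case_prod_unfold \<rho>_def by (intro continuous_intros ballI)
    have cg: "continuous_on UNIV (\<lambda>(x, y). (m x y)\<^sup>2 * g x y)"
      using cont_g unfolding case_prod_unfold by (intro continuous_intros cm)
    have cPQ: "continuous_on UNIV (\<lambda>(x, y). P' x y + Q' x y)"
      using continuous_on_add[OF cP cQ] by (simp add: case_prod_unfold)
    have ic: "u integrable_on S" if "continuous_on UNIV u" for u :: "real \<times> real \<Rightarrow> real"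
      using that unfolding S_def by (auto intro!: integrable_continuous intro: continuous_on_subset)
    note i = ic[OF cPQ] ic[OF c1] ic[OF cg]
    have "integral S (\<lambda>(x, y). (m x y)\<^sup>2 * g x y)
        \<le> integral S (\<lambda>p. 2 * (case p of (x, y) \<Rightarrow> P' x y + Q' x y)
            + 16 * k\<^sup>2 / L\<^sup>2 * (case p of (x, y) \<Rightarrow> 1 / (1 + x\<^sup>2 + y\<^sup>2)))"
      using pointwise
      by (intro integral_le i integrable_add integrable_on_mult_right) (auto simp: mult_ac)
    also have "\<dots> = 16 * k\<^sup>2 / L\<^sup>2 * integral S (\<lambda>(x, y). 1 / (1 + x\<^sup>2 + y\<^sup>2))"
      unfolding integral_mult_right int0
        integral_add[OF integrable_on_mult_right[OF i(1)] integrable_on_mult_right[OF i(2)]]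
      by simp
    also have "\<dots> \<le> 16 * k\<^sup>2 / L\<^sup>2 * (2 * pi * L)"
      unfolding S_def L_def by (intro mult_left_mono integral_inverse_quadratic_le R) auto
    also have "\<dots> = 32 * pi * k\<^sup>2 / L"
      using L by (simp add: field_simps power2_eq_square)
    finally show ?thesis
      unfolding S_def L_def m_def .
  qed
  have "g x y = 0" for x y
  proof -
    \<comment> \<open>The lower bound 1 guarantees a square with nonempty interior even if
      \<open>x\<close> and \<open>y\<close> are both 0; a nonnegative continuous function with zero
      integral over it must vanish there.\<close>
    define r where "r = max 1 (max \<bar>x\<bar> \<bar>y\<bar>)"
    define B where "B = cbox (- r, - r) (r, r)"
    have r: "r \<ge> 1" "(x, y) \<in> B" unfolding r_def B_def by auto
    have lim: "filterlim (\<lambda>R::real. ln (1 + R\<^sup>2)) at_top at_top"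
      by (intro filterlim_compose[OF ln_at_top] filterlim_tendsto_add_at_top[OF tendsto_const]
          filterlim_pow_at_top filterlim_ident) auto
    have "((\<lambda>R. 128 * pi * k\<^sup>2 / ln (1 + R\<^sup>2)) \<longlongrightarrow> 0) at_top"
      by (intro tendsto_divide_0[OF tendsto_const] filterlim_at_top_imp_at_infinity lim)
    \<comment> \<open>Once \<open>ln (1 + R^2)\<close> exceeds \<open>2 * ln (1 + 2 * r^2)\<close>,
      the cutoff is at least 1/2 on \<open>B\<close>, so its square costs a factor 4 and 32 becomes
      128. The condition \<open>R \<ge> r\<close> places \<open>B\<close> inside the large
      square.\<close>
    moreover have "\<forall>\<^sub>F R in at_top. integral B (\<lambda>(x, y). g x y) \<le> 128 * pi * k\<^sup>2 / ln (1 + R\<^sup>2)"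
      using filterlim_at_top[THEN iffD1, OF lim, rule_format, of "2 * ln (1 + 2 * r\<^sup>2)"]
        eventually_ge_at_top[of "max 2 r"]
    proof eventually_elim
      case (elim R)
      define L where "L = ln (1 + R\<^sup>2)"
      define w where "w = (\<lambda>(x, y). (max 0 (1 - ln (\<rho> x y) / L))\<^sup>2 * g x y)"
      have L: "L > 0" unfolding L_def using elim by (auto intro!: ln_gt_zero)
      have cw: "continuous_on UNIV w"
        using \<rho> L cont_g unfolding w_def case_prod_unfold by (intro continuous_intros c\<rho>) auto
      have "g x y / 4 \<le> w (x, y)" if "(x, y) \<in> B" for x y
      proof -
        have "\<bar>x\<bar> \<le> \<bar>r\<bar>" "\<bar>y\<bar> \<le> \<bar>r\<bar>" using that unfolding B_def by auto
        then have "x\<^sup>2 \<le> r\<^sup>2" "y\<^sup>2 \<le> r\<^sup>2" by (simp_all only: abs_le_square_iff)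
        then have "ln (\<rho> x y) \<le> ln (1 + 2 * r\<^sup>2)"
          using \<rho>[of x y] by (intro ln_mono) (auto simp: \<rho>_def)
        also have "\<dots> \<le> L / 2" using elim unfolding L_def by simp
        finally have "1 / 2 \<le> 1 - ln (\<rho> x y) / L" using L by (simp add: field_simps)
        then have "1 / 2 \<le> max 0 (1 - ln (\<rho> x y) / L)" by linarith
        then have "(1 / 2)\<^sup>2 \<le> (max 0 (1 - ln (\<rho> x y) / L))\<^sup>2"
          by (rule power_mono) simp
        then have "(1 / 2)\<^sup>2 * g x y \<le> (max 0 (1 - ln (\<rho> x y) / L))\<^sup>2 * g x y"
          by (rule mult_right_mono) (simp add: g_def)
        then show ?thesis unfolding w_def by (simp add: power2_eq_square)
      qed
      moreover have "(\<lambda>(x, y). g x y / 4) integrable_on B"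
        using cont_g unfolding B_def case_prod_unfold
        by (auto intro!: integrable_continuous continuous_intros intro: continuous_on_subset)
      moreover have iw: "w integrable_on cbox a b" for a b
        using cw by (auto intro!: integrable_continuous intro: continuous_on_subset)
      ultimately have "integral B (\<lambda>(x, y). g x y / 4) \<le> integral B w"
        unfolding B_def by (intro integral_le) auto
      also have "\<dots> \<le> integral (cbox (- R, - R) (R, R)) w"
        unfolding B_def using elim by (intro integral_subset_le iw) (auto simp: w_def g_def)
      also have "\<dots> \<le> 32 * pi * k\<^sup>2 / L"
        unfolding w_def L_def using weighted[of R] elim by simp
      finally show ?case
        unfolding L_def case_prod_unfold by simp
    qed
    ultimately have "integral B (\<lambda>(x, y). g x y) \<le> 0"
      by (intro tendsto_lowerbound) auto
    moreover have "integral B (\<lambda>(x, y). g x y) \<ge> 0"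
      unfolding B_def
      by (intro integral_nonneg integrable_continuous)
        (use cont_g in \<open>auto simp: g_def intro: continuous_on_subset\<close>)
    ultimately have "integral B (\<lambda>(x, y). g x y) = 0" by simp
    moreover have "(0, 0) \<in> box (- r, - r) (r, r)"
      using r by (simp add: mem_box Basis_prod_def)
    then have "box (- r, - r) (r, r) \<noteq> {}" by blast
    moreover have "0 \<le> (case p of (x, y) \<Rightarrow> g x y)" for p
      by (simp add: g_def split: prod.split)
    ultimately have "\<forall>p\<in>B. (case p of (x, y) \<Rightarrow> g x y) = 0"
      using integral_cbox_eq_0_iff[OF continuous_on_subset[OF cont_g subset_UNIV]] unfolding B_def by blast
    then show ?thesis using r by auto
  qed
  then show ?thesis unfolding g_def by simp
qed

subsection \<open>Minimal graphs in the Heisenberg group\<close>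

lemma matrix_inv_eqI:
  fixes A B :: "real^'n^'n"
  assumes "A ** B = mat 1"
  shows "matrix_inv A = B"
proof -
  have BA: "B ** A = mat 1" using assms by (simp add: matrix_left_right_inverse)
  have "A ** matrix_inv A = mat 1 \<and> matrix_inv A ** A = mat 1"
    \<comment> \<open>\<open>matrix_inv\<close> is a Hilbert choice, so its defining property is
      obtained from the witness \<open>B\<close>.\<close>
    unfolding matrix_inv_def using assms BA by (rule_tac someI[of _ B]) blast
  then have "B ** (A ** matrix_inv A) = B" by simp
  then show ?thesis by (simp add: matrix_mul_assoc BA)
qed

lemma matrix_inv_heis_metric:
  "matrix_inv (heis_metric p) = vector [vector [1, 0, - p$2 / 2], vector [0, 1, p$1 / 2],
     vector [- p$2 / 2, p$1 / 2, 1 + (p$1)\<^sup>2 / 4 + (p$2)\<^sup>2 / 4]]"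
  by (rule matrix_inv_eqI)
    (simp add: vec_eq_iff forall_3 matrix_matrix_mult_def sum_3 mat_def heis_metric_def heis_form_def
      algebra_simps power2_eq_square)

lemma has_derivative_vector_3:
  fixes a b c :: "'a::real_normed_vector \<Rightarrow> real"
  assumes "(a has_derivative a') (at z within S)"
    "(b has_derivative b') (at z within S)" "(c has_derivative c') (at z within S)"
  shows "((\<lambda>x. vector [a x, b x, c x] :: real^3) has_derivative (\<lambda>h. vector [a' h, b' h, c' h])) (at z within S)"
proof (subst has_derivative_componentwise_within, intro ballI)
  fix i :: "real^3" assume "i \<in> Basis"
  then obtain k :: 3 where "i = axis k 1" by (auto simp: Basis_vec_def)
  then show "((\<lambda>x. (vector [a x, b x, c x] :: real^3) \<bullet> i) has_derivative
      (\<lambda>h. vector [a' h, b' h, c' h] \<bullet> i)) (at z within S)"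
    using assms exhaust_3[of k] by (auto simp: inner_axis)
qed

lemma partial_deriv_vector_3:
  fixes a b c :: "real^'n \<Rightarrow> real"
  assumes "a differentiable at u" "b differentiable at u" "c differentiable at u"
  shows "partial_deriv i (\<lambda>x. vector [a x, b x, c x] :: real^3) u
    = vector [partial_deriv i a u, partial_deriv i b u, partial_deriv i c u]"
  unfolding partial_deriv_def
  by (subst frechet_derivative_at[symmetric, OF has_derivative_vector_3])
    (use assms in \<open>auto simp: frechet_derivative_works\<close>)

lemma partial_deriv_eqI: "(f has_derivative f') (at x) \<Longrightarrow> partial_deriv i f x = f' (axis i 1)"
  unfolding partial_deriv_def using frechet_derivative_at by metis

lemma partial_deriv_const [simp]: "partial_deriv i (\<lambda>_. c) x = 0"
  by (rule partial_deriv_eqI[THEN trans]) (rule has_derivative_const, simp)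

lemma partial_deriv_nth [simp]: "partial_deriv i (\<lambda>x. x $ j) x = axis i 1 $ j"
  by (rule partial_deriv_eqI) (rule bounded_linear.has_derivative[OF bounded_linear_vec_nth has_derivative_ident])

text \<open>Product rule: the metric is a constant matrix plus the products of components of
  \<open>heis_form\<close>, and \<open>heis_form\<close> is affine in the point.\<close>

lemma partial_deriv_heis_metric:
  "partial_deriv i (\<lambda>q. heis_metric q $ j $ l) p
    = heis_form p $ j * (vector [axis i 1 $ 2 / 2, - (axis i 1 $ 1) / 2, 0] :: real^3) $ l
      + (vector [axis i 1 $ 2 / 2, - (axis i 1 $ 1) / 2, 0] :: real^3) $ j * heis_form p $ l"
proof -
  have "(heis_form has_derivative (\<lambda>h. vector [h $ 2 / 2, - (h $ 1) / 2, 0])) (at p)"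
    unfolding heis_form_def
    by (rule has_derivative_vector_3)
      (auto intro!: derivative_eq_intros bounded_linear.has_derivative[OF bounded_linear_vec_nth])
  then have *: "((\<lambda>q. heis_form q $ m) has_derivative
      (\<lambda>h. (vector [h $ 2 / 2, - (h $ 1) / 2, 0] :: real^3) $ m)) (at p)" for m
    by (rule bounded_linear.has_derivative[OF bounded_linear_vec_nth])
  have "((\<lambda>q. heis_metric q $ j $ l) has_derivative
      (\<lambda>h. 0 + (heis_form p $ j * (vector [h $ 2 / 2, - (h $ 1) / 2, 0] :: real^3) $ l
        + (vector [h $ 2 / 2, - (h $ 1) / 2, 0] :: real^3) $ j * heis_form p $ l))) (at p)"
    unfolding heis_metric_def vec_lambda_beta
    by (intro has_derivative_add has_derivative_const has_derivative_mult *)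
  from partial_deriv_eqI[OF this] show ?thesis by simp
qed

lemma axis_3_nth:
  "(axis 1 1 :: real^3) = vector [1, 0, 0]" "(axis 2 1 :: real^3) = vector [0, 1, 0]"
  "(axis 3 1 :: real^3) = vector [0, 0, 1]"
  by (auto simp: vec_eq_iff axis_def forall_3)

text \<open>The vectors \<open>[1, 0, - p$2 / 2]\<close> and \<open>[0, 1, p$1 / 2]\<close> are the
  left-invariant horizontal frame, on which the contact form vanishes;
  \<open>heis_form p $ i\<close> is the value of that form on the \<open>i\<close>-th coordinate
  field. All 27 index triples are checked directly.\<close>

lemma christoffel_heis_metric:
  "christoffel heis_metric p k i j =
    ((heis_form p $ j * axis i 1 $ 2 + heis_form p $ i * axis j 1 $ 2) * (vector [1, 0, - p$2 / 2] :: real^3) $ k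
     - (heis_form p $ j * axis i 1 $ 1 + heis_form p $ i * axis j 1 $ 1) * (vector [0, 1, p$1 / 2] :: real^3) $ k) / 2"
proof -
  have "k = 1 \<or> k = 2 \<or> k = 3" "i = 1 \<or> i = 2 \<or> i = 3" "j = 1 \<or> j = 2 \<or> j = 3"
    by (rule exhaust_3)+
  then show ?thesis
    unfolding christoffel_def matrix_inv_heis_metric partial_deriv_heis_metric sum_3
    by (elim disjE; simp add: axis_3_nth heis_form_def; simp add: field_simps power2_eq_square)
qed

section \<open>Fundamental forms and mean curvature of a graph\<close>

lemma axis_2_nth:
  "(axis 1 1 :: real^2) = vector [1, 0]" "(axis 2 1 :: real^2) = vector [0, 1]"
  by (auto simp: vec_eq_iff axis_def forall_2)

lemma partial_deriv_graph_param:
  assumes "f differentiable at u"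
  shows "partial_deriv i (graph_param f) u = vector [axis i 1 $ 1, axis i 1 $ 2, partial_deriv i f u]"
proof -
  have "graph_param f = (\<lambda>u. vector [u$1, u$2, f u])" by (auto simp: graph_param_def)
  moreover have "(\<lambda>u::real^2. u $ j) differentiable at u" for j
    by (rule bounded_linear_imp_differentiable[OF bounded_linear_vec_nth])
  ultimately show ?thesis using assms by (simp add: partial_deriv_vector_3)
qed

lemma partial_deriv_2_graph_param:
  assumes "\<And>u. f differentiable at u" "partial_deriv j f differentiable at u"
  shows "partial_deriv i (partial_deriv j (graph_param f)) u = vector [0, 0, partial_deriv i (partial_deriv j f) u]"
proof -
  have "partial_deriv j (graph_param f) = (\<lambda>u. vector [axis j 1 $ 1, axis j 1 $ 2, partial_deriv j f u])"
    using assms(1) by (auto simp: partial_deriv_graph_param)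
  then show ?thesis using assms(2) by (simp add: partial_deriv_vector_3)
qed

text \<open>The mean curvature is computed for one explicit unit normal. Here \<open>p\<close> and
  \<open>q\<close> are the values of the contact form on the two coordinate tangent vectors; the
  mixed partials occur as a sum because the trace pairs both off-diagonal entries.\<close>

lemma minimal_graph_equation:
  fixes f :: "real^2 \<Rightarrow> real" and u :: "real^2"
  defines "p \<equiv> partial_deriv 1 f u + u$2 / 2" and "q \<equiv> partial_deriv 2 f u - u$1 / 2"
  assumes min: "minimal_surface heis_metric UNIV (graph_param f)"
    and d: "\<And>u. f differentiable at u" "\<And>j. partial_deriv j f differentiable at u"
  shows "(1 + q\<^sup>2) * partial_deriv 1 (partial_deriv 1 f) u
      - p * q * (partial_deriv 1 (partial_deriv 2 f) u + partial_deriv 2 (partial_deriv 1 f) u)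
      + (1 + p\<^sup>2) * partial_deriv 2 (partial_deriv 2 f) u = 0"
proof -
  define x y where "x = u$1" and "y = u$2"
  define f1 f2 where "f1 = partial_deriv 1 f u" and "f2 = partial_deriv 2 f u"
  define H where "H = (\<lambda>i j. partial_deriv i (partial_deriv j f) u)"
  define c where "c = 1 / sqrt (1 + p\<^sup>2 + q\<^sup>2)"
  \<comment> \<open>In the left-invariant orthonormal frame this normal has components
    \<open>-p\<close>, \<open>-q\<close>, 1, scaled by \<open>c\<close>.\<close>
  define \<nu> :: "real^3" where "\<nu> = vector [- p * c, - q * c, (1 + p * y / 2 - q * x / 2) * c]"
  have pq: "f1 = p - y / 2" "f2 = q + x / 2" by (simp_all add: p_def q_def f1_def f2_def x_def y_def)
  have W: "1 + p\<^sup>2 + q\<^sup>2 > 0" by (smt (verit) zero_le_power2)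
  then have c: "c > 0" "c\<^sup>2 * (1 + p\<^sup>2 + q\<^sup>2) = 1" unfolding c_def by (auto simp: power_divide)
  let ?X = "graph_param f"
  have X: "?X u = vector [x, y, f u]" by (simp add: graph_param_def x_def y_def)
  have X1: "partial_deriv 1 ?X u = vector [1, 0, f1]" and X2: "partial_deriv 2 ?X u = vector [0, 1, f2]"
    using d by (simp_all add: partial_deriv_graph_param f1_def f2_def axis_2_nth)
  have XX: "partial_deriv i (partial_deriv j ?X) u = vector [0, 0, H i j]" for i j
    using d by (simp add: partial_deriv_2_graph_param H_def)
  have "unit_normal heis_metric ?X u \<nu>"
    unfolding unit_normal_def forall_2 metric_inner_heis_metric X X1 X2 \<nu>_def pq
    using c by (simp add: algebra_simps power2_eq_square)
  then have 0: "mean_curvature heis_metric ?X \<nu> u = 0"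
    using min unfolding minimal_surface_def by auto
  have I: "first_fundamental_form heis_metric ?X u = vector [vector [1 + p\<^sup>2, p * q], vector [p * q, 1 + q\<^sup>2]]"
    by (simp add: vec_eq_iff forall_2 first_fundamental_form_def metric_inner_heis_metric X X1 X2 pq
        algebra_simps power2_eq_square add_divide_distrib diff_divide_distrib)
  \<comment> \<open>The first fundamental form has determinant \<open>1 + p^2 + q^2\<close>, the
    reciprocal of \<open>c^2\<close>.\<close>
  have inv: "matrix_inv (first_fundamental_form heis_metric ?X u)
      = vector [vector [(1 + q\<^sup>2) * c\<^sup>2, - (p * q * c\<^sup>2)], vector [- (p * q * c\<^sup>2), (1 + p\<^sup>2) * c\<^sup>2]]"
    unfolding I using c
    by (intro matrix_inv_eqI)
      (auto simp: vec_eq_iff forall_2 matrix_matrix_mult_def sum_2 mat_def algebra_simps power2_eq_square)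
  define \<Gamma> where "\<Gamma> = (\<lambda>(v::real^3) (w::real^3). (\<chi> k. \<Sum>a\<in>UNIV. \<Sum>b\<in>UNIV. christoffel heis_metric (vector [x, y, f u]) k a b * v$a * w$b))"
  have \<Gamma>: "\<Gamma> v w = vector [g2 / 2, - g1 / 2, - (g2 * y + g1 * x) / 4]"
    if "\<omega> = (\<lambda>v. y / 2 * v$1 - x / 2 * v$2 + v$3)"
      "g1 = \<omega> w * v$1 + \<omega> v * w$1" "g2 = \<omega> w * v$2 + \<omega> v * w$2" for v w :: "real^3" and \<omega> g1 g2
    unfolding that vec_eq_iff \<Gamma>_def forall_3
    by (simp add: christoffel_heis_metric sum_3 axis_3_nth heis_form_def)
      (simp add: algebra_simps add_divide_distrib diff_divide_distrib)
  have cov: "cov_deriv heis_metric ?X i j u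
      = vector [0, 0, H i j] + \<Gamma> (partial_deriv i ?X u) (partial_deriv j ?X u)" for i j
    unfolding cov_deriv_def XX \<Gamma>_def X ..
  let ?II = "second_fundamental_form heis_metric ?X \<nu> u"
  have II: "?II $ 1 $ 1 = c * (H 1 1 + p * q)" "?II $ 2 $ 2 = c * (H 2 2 - p * q)"
    "?II $ 1 $ 2 = c * (H 1 2 + (q\<^sup>2 - p\<^sup>2) / 2)" "?II $ 2 $ 1 = c * (H 2 1 + (q\<^sup>2 - p\<^sup>2) / 2)"
    unfolding second_fundamental_form_def vec_lambda_beta cov X1 X2 \<Gamma>[OF refl refl refl]
      metric_inner_heis_metric X \<nu>_def pq
    by (simp_all add: field_simps power2_eq_square)
  \<comment> \<open>The connection terms \<open>p * q\<close> and \<open>(q^2 - p^2) / 2\<close>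
    cancel in the trace, so only second derivatives of \<open>f\<close> survive.\<close>
  have "mean_curvature heis_metric ?X \<nu> u = c^3 / 2 *
      ((1 + q\<^sup>2) * H 1 1 - p * q * (H 1 2 + H 2 1) + (1 + p\<^sup>2) * H 2 2)"
    unfolding mean_curvature_def inv
    by (simp add: trace_def matrix_matrix_mult_def sum_2 II)
      (simp add: field_simps power2_eq_square power3_eq_cube)
  then show ?thesis using 0 c by (simp add: H_def)
qed

subsection \<open>Bounded solutions of the minimal graph equation\<close>

lemma sqrt_one_plus_squares:
  fixes p q :: real
  defines "w \<equiv> sqrt (1 + p\<^sup>2 + q\<^sup>2)"
  shows "0 < w" "1 \<le> w" "w\<^sup>2 = 1 + p\<^sup>2 + q\<^sup>2" "(p / w)\<^sup>2 + (q / w)\<^sup>2 = 1 - 1 / w\<^sup>2"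
proof -
  have 1: "1 \<le> 1 + p\<^sup>2 + q\<^sup>2" by simp
  then show "1 \<le> w" "w\<^sup>2 = 1 + p\<^sup>2 + q\<^sup>2" unfolding w_def by auto
  then show "0 < w" by linarith
  have "(p / w)\<^sup>2 + (q / w)\<^sup>2 = (w\<^sup>2 - 1) / w\<^sup>2"
    unfolding \<open>w\<^sup>2 = 1 + p\<^sup>2 + q\<^sup>2\<close> power_divide by (simp add: add_divide_distrib)
  also have "\<dots> = 1 - 1 / w\<^sup>2"
    using \<open>0 < w\<close> by (simp add: diff_divide_distrib)
  finally show "(p / w)\<^sup>2 + (q / w)\<^sup>2 = 1 - 1 / w\<^sup>2" .
qed

text \<open>For the normalized vectors \<open>A\<close>, \<open>B\<close> the right side equals
  \<open>(w + u) / 2 * |A - B|^2 + (w - u) * (|A|^2 - |B|^2) / 2\<close>. The last term is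
  nonnegative since \<open>|A|^2 = 1 - 1 / w^2\<close> increases with \<open>w\<close>, and
  \<open>w\<close>, \<open>u\<close> are at least 1.\<close>

lemma normalized_gradient_coercive:
  fixes p q a b :: real
  defines "w \<equiv> sqrt (1 + p\<^sup>2 + q\<^sup>2)" and "u \<equiv> sqrt (1 + a\<^sup>2 + b\<^sup>2)"
  shows "(p / w - a / u)\<^sup>2 + (q / w - b / u)\<^sup>2 \<le> (p - a) * (p / w - a / u) + (q - b) * (q / w - b / u)"
proof -
  note w = sqrt_one_plus_squares[of p q, folded w_def] and u = sqrt_one_plus_squares[of a b, folded u_def]
  define \<alpha> \<beta> \<gamma> \<delta> where "\<alpha> = p / w" and "\<beta> = q / w" and "\<gamma> = a / u" and "\<delta> = b / u"
  have eqs: "p = w * \<alpha>" "q = w * \<beta>" "a = u * \<gamma>" "b = u * \<delta>"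
    using w u by (auto simp: \<alpha>_def \<beta>_def \<gamma>_def \<delta>_def)
  have n: "\<alpha>\<^sup>2 + \<beta>\<^sup>2 = 1 - 1 / w\<^sup>2" "\<gamma>\<^sup>2 + \<delta>\<^sup>2 = 1 - 1 / u\<^sup>2"
    using w(4) u(4) by (simp_all add: \<alpha>_def \<beta>_def \<gamma>_def \<delta>_def)
  define D where "D = (\<alpha> - \<gamma>)\<^sup>2 + (\<beta> - \<delta>)\<^sup>2"
  have "(w - u) * (1 / u\<^sup>2 - 1 / w\<^sup>2) = (w - u)\<^sup>2 * (w + u) / (u\<^sup>2 * w\<^sup>2)"
    using w(1) u(1) by (simp add: field_simps power2_eq_square)
  then have "0 \<le> (w - u) * ((\<alpha>\<^sup>2 + \<beta>\<^sup>2) - (\<gamma>\<^sup>2 + \<delta>\<^sup>2))"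
    unfolding n using w(1) u(1) by simp
  moreover have "1 * D \<le> (w + u) / 2 * D"
    using w(2) u(2) by (intro mult_right_mono) (auto simp: D_def)
  moreover have "(w * \<alpha> - u * \<gamma>) * (\<alpha> - \<gamma>) + (w * \<beta> - u * \<delta>) * (\<beta> - \<delta>)
      = (w + u) / 2 * D + (w - u) * ((\<alpha>\<^sup>2 + \<beta>\<^sup>2) - (\<gamma>\<^sup>2 + \<delta>\<^sup>2)) / 2"
    unfolding D_def by (simp add: field_simps power2_eq_square)
  ultimately show ?thesis
    unfolding \<alpha>_def[symmetric] \<beta>_def[symmetric] \<gamma>_def[symmetric] \<delta>_def[symmetric]
    using eqs by (simp add: D_def)
qed

text \<open>The length of the normalized vector determines \<open>w\<close> through
  \<open>1 - 1 / w^2\<close>, and multiplying by \<open>w\<close> recovers the vector.\<close>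

lemma normalized_gradient_inj:
  fixes p q a b :: real
  assumes "p / sqrt (1 + p\<^sup>2 + q\<^sup>2) = a / sqrt (1 + a\<^sup>2 + b\<^sup>2)"
    and "q / sqrt (1 + p\<^sup>2 + q\<^sup>2) = b / sqrt (1 + a\<^sup>2 + b\<^sup>2)"
  shows "p = a \<and> q = b"
proof -
  define w u where "w = sqrt (1 + p\<^sup>2 + q\<^sup>2)" and "u = sqrt (1 + a\<^sup>2 + b\<^sup>2)"
  note w = sqrt_one_plus_squares[of p q, folded w_def] and u = sqrt_one_plus_squares[of a b, folded u_def]
  have "1 / w\<^sup>2 = 1 - (p / w)\<^sup>2 - (q / w)\<^sup>2" "1 / u\<^sup>2 = 1 - (a / u)\<^sup>2 - (b / u)\<^sup>2"
    using w(4) u(4) by linarith+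
  then have "1 / w\<^sup>2 = 1 / u\<^sup>2"
    using assms unfolding w_def[symmetric] u_def[symmetric] by simp
  then have "w = u" using w(1) u(1) by (simp add: power2_eq_iff_nonneg)
  then show ?thesis
    using assms w(1) unfolding w_def[symmetric] u_def[symmetric] by simp
qed

text \<open>Over the common denominator \<open>w^3\<close> the numerator acquires exactly the
  coefficients \<open>1 + q^2\<close> and \<open>- p * q\<close> of the minimal graph
  equation.\<close>

lemma DERIV_normalized_gradient:
  fixes P Q :: "real \<Rightarrow> real"
  assumes P: "(P has_real_derivative P') (at t)" and Q: "(Q has_real_derivative Q') (at t)"
  shows "((\<lambda>t. P t / sqrt (1 + (P t)\<^sup>2 + (Q t)\<^sup>2)) has_real_derivative
      ((1 + (Q t)\<^sup>2) * P' - P t * Q t * Q') / (sqrt (1 + (P t)\<^sup>2 + (Q t)\<^sup>2))^3) (at t)"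
proof -
  define w where "w = sqrt (1 + (P t)\<^sup>2 + (Q t)\<^sup>2)"
  note w = sqrt_one_plus_squares[of "P t" "Q t", folded w_def]
  have "((\<lambda>t. sqrt (1 + (P t)\<^sup>2 + (Q t)\<^sup>2)) has_real_derivative (P t * P' + Q t * Q') / w) (at t)"
    using w(1) unfolding w_def
    by (auto intro!: derivative_eq_intros P Q simp: field_simps)
  then have "((\<lambda>t. P t / sqrt (1 + (P t)\<^sup>2 + (Q t)\<^sup>2)) has_real_derivative
      (P' * w - P t * ((P t * P' + Q t * Q') / w)) / (w * w)) (at t)"
    using w(1) unfolding w_def by (intro DERIV_divide P) auto
  moreover have "(P' * w - P t * ((P t * P' + Q t * Q') / w)) / (w * w)
      = (P' * w\<^sup>2 - P t * (P t * P' + Q t * Q')) / w^3"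
    using w(1) by (simp add: field_simps power2_eq_square power3_eq_cube)
  ultimately show ?thesis
    unfolding w(3) w_def[symmetric] by (simp add: algebra_simps power2_eq_square)
qed

text \<open>Dividing the equation by \<open>w^3\<close> puts it in divergence form, so that the
  Liouville theorem above applies to the difference with the field of the zero function.\<close>

lemma bounded_solution_gradient_eq_0:
  fixes f f1 f2 f11 f12 f21 f22 :: "real \<Rightarrow> real \<Rightarrow> real"
  defines "p \<equiv> (\<lambda>x y. f1 x y + y / 2)" and "q \<equiv> (\<lambda>x y. f2 x y - x / 2)"
  assumes f1: "\<And>x y. ((\<lambda>x. f x y) has_real_derivative f1 x y) (at x)"
    and f2: "\<And>x y. ((\<lambda>y. f x y) has_real_derivative f2 x y) (at y)"
    and f11: "\<And>x y. ((\<lambda>x. f1 x y) has_real_derivative f11 x y) (at x)"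
    and f21: "\<And>x y. ((\<lambda>y. f1 x y) has_real_derivative f21 x y) (at y)"
    and f12: "\<And>x y. ((\<lambda>x. f2 x y) has_real_derivative f12 x y) (at x)"
    and f22: "\<And>x y. ((\<lambda>y. f2 x y) has_real_derivative f22 x y) (at y)"
    and cont: "continuous_on UNIV (\<lambda>(x, y). f x y)"
      "continuous_on UNIV (\<lambda>(x, y). f1 x y)" "continuous_on UNIV (\<lambda>(x, y). f2 x y)"
      "continuous_on UNIV (\<lambda>(x, y). f11 x y)" "continuous_on UNIV (\<lambda>(x, y). f21 x y)"
      "continuous_on UNIV (\<lambda>(x, y). f12 x y)" "continuous_on UNIV (\<lambda>(x, y). f22 x y)"
    and bounded: "\<And>x y. \<bar>f x y\<bar> \<le> k"
    and eq: "\<And>x y. (1 + (q x y)\<^sup>2) * f11 x y - p x y * q x y * (f12 x y + f21 x y)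
      + (1 + (p x y)\<^sup>2) * f22 x y = 0"
  shows "f1 x y = 0 \<and> f2 x y = 0"
proof -
  define w where "w p q = sqrt (1 + p\<^sup>2 + q\<^sup>2)" for p q :: real
  have w: "w a b \<noteq> 0" for a b unfolding w_def using sqrt_one_plus_squares(1)[of a b] by simp
  have w_swap: "w a b = w b a" for a b by (simp add: w_def add.commute add.left_commute)
  have w_neg: "w a (- b) = w a b" for a b by (simp add: w_def)
  note Dw = DERIV_normalized_gradient[folded w_def]
  \<comment> \<open>In \<open>V2\<close> the arguments of \<open>w\<close> are exchanged so that the
    same derivative rule serves both components; \<open>w_swap\<close> undoes this later.\<close>
  define V1 where "V1 = (\<lambda>x y. p x y / w (p x y) (q x y) - (y / 2) / w (y / 2) (- x / 2))"
  define V2 where "V2 = (\<lambda>x y. q x y / w (q x y) (p x y) - (- x / 2) / w (- x / 2) (y / 2))"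
  \<comment> \<open>\<open>V11\<close> and \<open>V22\<close> copy the output of that rule; the
    factors 0 are derivatives of \<open>y / 2\<close> along \<open>x\<close> and of
    \<open>- x / 2\<close> along \<open>y\<close>.\<close>
  define V11 where "V11 = (\<lambda>x y. ((1 + (q x y)\<^sup>2) * f11 x y - p x y * q x y * (f12 x y - 1 / 2)) / w (p x y) (q x y) ^ 3
      - ((1 + (- x / 2)\<^sup>2) * 0 - y / 2 * (- x / 2) * (- 1 / 2)) / w (y / 2) (- x / 2) ^ 3)"
  define V22 where "V22 = (\<lambda>x y. ((1 + (p x y)\<^sup>2) * f22 x y - q x y * p x y * (f21 x y + 1 / 2)) / w (q x y) (p x y) ^ 3
      - ((1 + (y / 2)\<^sup>2) * 0 - (- x / 2) * (y / 2) * (1 / 2)) / w (- x / 2) (y / 2) ^ 3)"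
  have p1: "((\<lambda>x. p x y) has_real_derivative f11 x y) (at x)"
    and p2: "((\<lambda>y. p x y) has_real_derivative f21 x y + 1 / 2) (at y)"
    and q1: "((\<lambda>x. q x y) has_real_derivative f12 x y - 1 / 2) (at x)"
    and q2: "((\<lambda>y. q x y) has_real_derivative f22 x y) (at y)" for x y
    unfolding p_def q_def by (auto intro!: derivative_eq_intros f11 f12 f21 f22)
  have h: "((\<lambda>x::real. - x / 2) has_real_derivative - 1 / 2) (at x)"
    "((\<lambda>x::real. x / 2) has_real_derivative 1 / 2) (at x)" for x
    by (auto intro!: derivative_eq_intros)
  note cont' = cont[unfolded case_prod_unfold]
  have cpq: "continuous_on UNIV (\<lambda>z. p (fst z) (snd z))" "continuous_on UNIV (\<lambda>z. q (fst z) (snd z))"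
    unfolding p_def q_def by (intro continuous_intros cont'; simp)+
  have cw: "continuous_on UNIV (\<lambda>z. w (a z) (b z))"
    if "continuous_on UNIV a" "continuous_on UNIV b" for a b :: "real \<times> real \<Rightarrow> real"
    unfolding w_def by (intro continuous_intros that)
  have "V1 x y = 0 \<and> V2 x y = 0"
  proof (rule divergence_free_field_eq_0[of f f1 f2 V1 V11 V2 V22 k, OF f1 f2 _ _ cont(1-3) _ _ _ _ bounded])
    show "((\<lambda>x. V1 x y) has_real_derivative V11 x y) (at x)" for x y
      unfolding V1_def V11_def
      by (rule DERIV_diff[OF Dw[OF p1 q1] Dw[OF DERIV_const h(1)]])
    show "((\<lambda>y. V2 x y) has_real_derivative V22 x y) (at y)" for x y
      unfolding V2_def V22_def
      by (rule DERIV_diff[OF Dw[OF q2 p2] Dw[OF DERIV_const h(2)]])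
    show "continuous_on UNIV (\<lambda>(x, y). V1 x y)" "continuous_on UNIV (\<lambda>(x, y). V2 x y)"
      "continuous_on UNIV (\<lambda>(x, y). V11 x y)" "continuous_on UNIV (\<lambda>(x, y). V22 x y)"
      unfolding V1_def V2_def V11_def V22_def case_prod_unfold
      by (intro continuous_intros cw cpq cont' ballI; simp add: w)+
    \<comment> \<open>The shifts by 1/2 in the mixed terms have opposite signs and cancel, as do the
      two contributions of the zero function.\<close>
    show "V11 x y + V22 x y = 0" for x y
    proof -
      have "V11 x y + V22 x y = ((1 + (q x y)\<^sup>2) * f11 x y - p x y * q x y * (f12 x y + f21 x y)
          + (1 + (p x y)\<^sup>2) * f22 x y) / w (p x y) (q x y) ^ 3"
        unfolding V11_def V22_def w_swap[of "q x y"] w_swap[of "- x / 2"]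
        by (simp add: add_divide_distrib diff_divide_distrib algebra_simps)
      then show ?thesis by (simp add: eq)
    qed
    show "(V1 x y)\<^sup>2 + (V2 x y)\<^sup>2 \<le> f1 x y * V1 x y + f2 x y * V2 x y" for x y
    proof -
      have "f1 x y = p x y - y / 2" "f2 x y = q x y - (- x / 2)" by (simp_all add: p_def q_def)
      then show ?thesis
        using normalized_gradient_coercive[of "p x y" "q x y" "y / 2" "- x / 2", folded w_def]
        unfolding V1_def V2_def w_swap[of "q x y"] w_swap[of "- x / 2"] by simp
    qed
  qed
  then have "p x y = y / 2 \<and> q x y = - x / 2"
    unfolding V1_def V2_def w_swap[of "q x y"] w_swap[of "- x / 2"]
    by (intro normalized_gradient_inj) (simp_all add: w_def)
  then show ?thesis by (simp add: p_def q_def)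
qed

section \<open>Transfer from \<open>real^2\<close> to functions of two real variables\<close>

theorem proposition5p4:
  fixes f :: "real^2 \<Rightarrow> real"
  assumes "smooth_on UNIV f"
    and "minimal_surface heis_metric UNIV (graph_param f)"
    and "\<exists>k. \<forall>u. \<bar>f u\<bar> \<le> k"
  shows "f constant_on UNIV"
proof -
  \<comment> \<open>Composition with \<open>pt\<close> turns \<open>partial_deriv\<close> into
    ordinary one-variable derivatives.\<close>
  define pt :: "real \<Rightarrow> real \<Rightarrow> real^2" where "pt = (\<lambda>x y. x *\<^sub>R axis 1 1 + y *\<^sub>R axis 2 1)"
  have pt_nth: "pt x y $ 1 = x" "pt x y $ 2 = y" for x y
    by (simp_all add: pt_def axis_def)
  have pt_surj: "pt (u $ 1) (u $ 2) = u" for u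
    by (simp add: vec_eq_iff forall_2 pt_nth)
  have smooth: "foldr partial_deriv is f differentiable (at u)" for "is" u
    using assms(1) by (simp add: smooth_on_def)
  note d0 = smooth[of "[]", simplified] and d1 = smooth[of "[i]" for i, simplified]
    and d2 = smooth[of "[i, j]" for i j, simplified]
  have pderiv: "((\<lambda>x. g (pt x y)) has_real_derivative partial_deriv 1 g (pt x y)) (at x)"
    "((\<lambda>y. g (pt x y)) has_real_derivative partial_deriv 2 g (pt x y)) (at y)"
    if "\<And>u. g differentiable (at u)" for g :: "real^2 \<Rightarrow> real" and x y
  proof -
    have g: "(g has_derivative frechet_derivative g (at u)) (at u)" for u
      using that by (simp add: frechet_derivative_works)
    have scale: "frechet_derivative g (at u) (t *\<^sub>R v) = t * frechet_derivative g (at u) v" for u t v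
      using linear_frechet_derivative[OF that] by (simp add: linear_scale)
    have "((\<lambda>x. pt x y) has_derivative (\<lambda>t. t *\<^sub>R axis 1 1)) (at x)"
      "((\<lambda>y. pt x y) has_derivative (\<lambda>t. t *\<^sub>R axis 2 1)) (at y)"
      unfolding pt_def by (auto intro!: derivative_eq_intros)
    from this[THEN has_derivative_compose, OF g] show
      "((\<lambda>x. g (pt x y)) has_real_derivative partial_deriv 1 g (pt x y)) (at x)"
      "((\<lambda>y. g (pt x y)) has_real_derivative partial_deriv 2 g (pt x y)) (at y)"
      by (simp_all add: has_field_derivative_def scale partial_deriv_def mult_commute_abs)
  qed
  have cont: "continuous_on UNIV (\<lambda>(x, y). g (pt x y))"
    if "\<And>u. g differentiable (at u)" for g :: "real^2 \<Rightarrow> real"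
  proof -
    have "continuous_on UNIV g"
      using that by (auto intro!: continuous_at_imp_continuous_on differentiable_imp_continuous_within)
    then show ?thesis
      unfolding case_prod_unfold
      by (rule continuous_on_compose2) (auto simp: pt_def intro!: continuous_intros)
  qed
  obtain k where k: "\<And>u. \<bar>f u\<bar> \<le> k" using assms(3) by blast
  have "partial_deriv 1 f (pt x y) = 0 \<and> partial_deriv 2 f (pt x y) = 0" for x y
    by (rule bounded_solution_gradient_eq_0[OF pderiv(1)[OF d0] pderiv(2)[OF d0] pderiv(1)[OF d1]
          pderiv(2)[OF d1] pderiv(1)[OF d1] pderiv(2)[OF d1]
          cont[OF d0] cont[OF d1] cont[OF d1] cont[OF d2] cont[OF d2] cont[OF d2] cont[OF d2] k])
      (fact minimal_graph_equation[OF assms(2) d0 d1, of "pt x y" for x y, unfolded pt_nth])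
  then have zero: "partial_deriv 1 f u = 0" "partial_deriv 2 f u = 0" for u
    using pt_surj[of u] by metis+
  have "(f has_derivative (\<lambda>h. 0)) (at u)" for u
  proof -
    have lin: "linear (frechet_derivative f (at u))"
      by (rule linear_frechet_derivative[OF d0])
    have "frechet_derivative f (at u) h = 0" for h
    proof -
      \<comment> \<open>Every direction is a combination of the two axis vectors, on which the
        derivative already vanishes.\<close>
      have "frechet_derivative f (at u) (pt (h $ 1) (h $ 2)) = 0"
        unfolding pt_def using zero[of u] lin
        by (simp add: partial_deriv_def linear_add linear_scale)
      then show ?thesis by (simp add: pt_surj)
    qed
    then have "frechet_derivative f (at u) = (\<lambda>h. 0)" by auto
    then show ?thesis using d0[of u] by (simp add: frechet_derivative_works)
  qed
  then have "\<exists>c. \<forall>u\<in>UNIV. f u = c"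
    by (intro has_derivative_zero_constant) auto
  then show ?thesis by (simp add: constant_on_def)
qed

end
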